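(* (Poincaré duality) Let $k$ be a perfect field of characteristic $p>0$, $G=\mathbb{Z}/(p)$, $V=\bigoplus_{\lambda=1}^{l}V_{d_\lambda}$ ($1\le d_\lambda\le p$) a $G$-representation over $k$ of dimension $d$ with $D_V\ge p$, and $X=V/G$. Let $\mathcal{W}$ be either of the quotient stacks $\mathcal{W}_1=[(V\setminus\{0\})/(\mathbb{G}_m\times G)]$ or $\mathcal{W}_2=[(X\setminus\{0\})/\mathbb{G}_m]$. Writing $M_{\mathrm{st}}(\mathcal{W})$ as $M_{\mathrm{st}}(\mathcal{W};\mathbb{L})$ to indicate that it is a rational function in $\mathbb{L}$, we have $$M_{\mathrm{st}}(\mathcal{W};\mathbb{L}^{-1})\,\mathbb{L}^{d-1}=M_{\mathrm{st}}(\mathcal{W};\mathbb{L}).$$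
   Context: $V_a$ ($1\le a\le p$) is the unique indecomposable $G$-representation over $k$ of dimension $a$; $D_V=\sum_{\lambda=1}^{l}\frac{(d_\lambda-1)d_\lambda}{2}$; for $1\le s\le p-1$, $\mathrm{sht}_V(s)=\sum_{\lambda=1}^{l}\sum_{i=1}^{d_\lambda-1}\lfloor is/p\rfloor$. $\mathbb{G}_m$ acts on $V$ by scaling, and compatibly on $X$; $\mathbb{L}$ is the class of the affine line in the (localized and completed) Grothendieck ring of varieties. The stringy motivic invariant of $\mathcal{W}_1$ and $\mathcal{W}_2$ is defined by $$M_{\mathrm{st}}(\mathcal{W}_1)=M_{\mathrm{st}}(\mathcal{W}_2):=\frac{\mathbb{L}^d-\mathbb{L}^l}{\mathbb{L}-1}+\bigl(M_{\mathrm{st}}(X)-(\mathbb{L}^d-\mathbb{L}^l)\bigr)\frac{\mathbb{L}^l-1}{\mathbb{L}^l(\mathbb{L}-1)},$$ where $M_{\mathrm{st}}(X)=\int_{J_\infty X}\mathbb{L}^{\mathrm{ord}\,\mathrm{Jac}_X^\omega}d\mu_X$ is the stringy motivic invariant of $X$ (the motivic integral over the arc space $J_\infty X$, with $\mathrm{Im}(\bigwedge^d\Omega_{X/k}\to\omega_X)=\mathrm{Jac}_X^\omega\cdot\omega_X$). For $D_V\ge p$ this is given by the rational function in $\mathbb{L}$ $$M_{\mathrm{st}}(X)=\mathbb{L}^{d}+\frac{\mathbb{L}^{l-1}(\mathbb{L}-1)\left(\sum_{s=1}^{p-1}\mathbb{L}^{s-\mathrm{sht}_V(s)}\right)}{1-\mathbb{L}^{p-1-D_V}},$$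 and $M_{\mathrm{st}}(\mathcal{W};\mathbb{L})$ denotes the rational function in $\mathbb{L}$ (an indeterminate) obtained by substituting this expression in the definition; $M_{\mathrm{st}}(\mathcal{W};\mathbb{L}^{-1})$ is obtained by substituting $\mathbb{L}^{-1}$ for $\mathbb{L}$. *)

theory Defs
  imports
    "HOL-Algebra.Elementary_Groups"
    "HOL-Computational_Algebra.Computational_Algebra"
begin

section \<open>Representations and their decomposition into indecomposables\<close>

definition perfect_field_of_char :: "nat \<Rightarrow> 'k :: field itself \<Rightarrow> bool" where
  "perfect_field_of_char p _ \<longleftrightarrow> p > 0 \<and> CHAR('k) = p \<and> surj (\<lambda>x :: 'k. x ^ p)"

definition group_representation ::
  "('g, 'm) monoid_scheme \<Rightarrow> ('k :: field \<Rightarrow> 'v :: ab_group_add \<Rightarrow> 'v) \<Rightarrow> ('g \<Rightarrow> 'v \<Rightarrow> 'v) \<Rightarrow> bool" where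
  "group_representation G scale \<rho> \<longleftrightarrow>
     group G \<and> vector_space scale \<and>
     (\<forall>g \<in> carrier G. Vector_Spaces.linear scale scale (\<rho> g)) \<and>
     \<rho> \<one>\<^bsub>G\<^esub> = id \<and>
     (\<forall>g \<in> carrier G. \<forall>h \<in> carrier G. \<rho> (g \<otimes>\<^bsub>G\<^esub> h) = \<rho> g \<circ> \<rho> h)"

definition subrepresentation ::
  "('g, 'm) monoid_scheme \<Rightarrow> ('k :: field \<Rightarrow> 'v :: ab_group_add \<Rightarrow> 'v) \<Rightarrow> ('g \<Rightarrow> 'v \<Rightarrow> 'v) \<Rightarrow> 'v set \<Rightarrow> bool" where
  "subrepresentation G scale \<rho> U \<longleftrightarrow>
     module.subspace scale U \<and> (\<forall>g \<in> carrier G. \<rho> g ` U \<subseteq> U)"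

definition indecomposable_subrepresentation ::
  "('g, 'm) monoid_scheme \<Rightarrow> ('k :: field \<Rightarrow> 'v :: ab_group_add \<Rightarrow> 'v) \<Rightarrow> ('g \<Rightarrow> 'v \<Rightarrow> 'v) \<Rightarrow> 'v set \<Rightarrow> bool" where
  "indecomposable_subrepresentation G scale \<rho> U \<longleftrightarrow>
     subrepresentation G scale \<rho> U \<and> U \<noteq> {0} \<and>
     \<not> (\<exists>U1 U2. subrepresentation G scale \<rho> U1 \<and> subrepresentation G scale \<rho> U2 \<and>
          U1 \<noteq> {0} \<and> U2 \<noteq> {0} \<and> U1 \<inter> U2 = {0} \<and> U = {u1 + u2 | u1 u2. u1 \<in> U1 \<and> u2 \<in> U2})"

definition internal_direct_sum :: "'i set \<Rightarrow> ('i \<Rightarrow> 'v :: ab_group_add set) \<Rightarrow> bool" where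
  "internal_direct_sum I U \<longleftrightarrow> (\<forall>v. \<exists>!u. u \<in> (\<Pi>\<^sub>E i\<in>I. U i) \<and> v = (\<Sum>i\<in>I. u i))"

text \<open>
  \<open>V = V\<^sub>d\<^sub>1 \<oplus> \<dots> \<oplus> V\<^sub>d\<^sub>l\<close> for \<open>G = \<int>/(p)\<close>. As \<open>V\<^sub>a\<close> is the unique indecomposable representation
  of dimension \<open>a\<close>, the summand isomorphic to \<open>V\<^sub>a\<close> is an indecomposable subrepresentation of
  dimension \<open>a\<close>. The library's \<open>dim\<close> is \<open>0\<close> on spaces of infinite dimension; \<open>1 \<le> dd j\<close>
  excludes these. The space \<open>V\<close> is the whole type \<open>'v\<close>.
\<close>

definition decomposes_as ::
  "nat \<Rightarrow> ('k :: field \<Rightarrow> 'v :: ab_group_add \<Rightarrow> 'v) \<Rightarrow> (int \<Rightarrow> 'v \<Rightarrow> 'v) \<Rightarrow> nat \<Rightarrow> (nat \<Rightarrow> nat) \<Rightarrow> bool" where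
  "decomposes_as p scale \<rho> l dd \<longleftrightarrow>
     (\<exists>U. internal_direct_sum {1..l} U \<and>
        (\<forall>j\<in>{1..l}. indecomposable_subrepresentation (integer_mod_group p) scale \<rho> (U j) \<and>
                     1 \<le> dd j \<and> dd j \<le> p \<and> vector_space.dim scale (U j) = dd j))"


section \<open>Numerical invariants\<close>

text \<open>The division in \<open>D_inv\<close> is exact; the one in \<open>sht\<close> is the floor of \<open>i s / p\<close>.\<close>

definition D_inv :: "nat \<Rightarrow> (nat \<Rightarrow> nat) \<Rightarrow> nat" where
  "D_inv l dd = (\<Sum>j=1..l. ((dd j - 1) * dd j) div 2)"

definition sht :: "nat \<Rightarrow> nat \<Rightarrow> (nat \<Rightarrow> nat) \<Rightarrow> nat \<Rightarrow> nat" where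
  "sht p l dd s = (\<Sum>j=1..l. \<Sum>i=1..dd j - 1. (i * s) div p)"


section \<open>Rational functions in an indeterminate\<close>

type_synonym ratfun = "int poly fract"

definition LL :: ratfun where
  "LL = to_fract [:0, 1:]"

definition ratfun_const :: "int \<Rightarrow> ratfun" where
  "ratfun_const c = to_fract [:c:]"

text \<open>
  \<open>R(g)\<close>, computed from the reduced fraction of \<open>R\<close>; meaningful if the denominator of \<open>R\<close>
  does not vanish at \<open>g\<close>, which always holds for nonconstant \<open>g\<close>.
\<close>

definition ratfun_subst :: "ratfun \<Rightarrow> ratfun \<Rightarrow> ratfun" where
  "ratfun_subst R g =
     poly (map_poly ratfun_const (fst (quot_of_fract R))) g /
     poly (map_poly ratfun_const (snd (quot_of_fract R))) g"


section \<open>Stringy motivic invariants as rational functions\<close>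

text \<open>
  The value of the motivic integral \<open>M\<^sub>s\<^sub>t(X)\<close>, \<open>X = V/G\<close>, for \<open>D\<^sub>V \<ge> p\<close>. The exponents may be
  negative, hence integer powers.
\<close>

definition Mst_X :: "nat \<Rightarrow> nat \<Rightarrow> nat \<Rightarrow> (nat \<Rightarrow> nat) \<Rightarrow> ratfun" where
  "Mst_X p d l dd =
     LL ^ d +
     LL powi (int l - 1) * (LL - 1) * (\<Sum>s=1..p - 1. LL powi (int s - int (sht p l dd s))) /
       (1 - LL powi (int p - 1 - int (D_inv l dd)))"

text \<open>
  \<open>W1\<close> and \<open>W2\<close> name the quotient stacks \<open>[(V \<setminus> {0})/(G\<^sub>m \<times> G)]\<close> and \<open>[(X \<setminus> {0})/G\<^sub>m]\<close>,
  whose stringy motivic invariants are by definition given by the same formula in \<open>M\<^sub>s\<^sub>t(X)\<close>.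
\<close>

datatype quotient_stack = W1 | W2

fun Mst_W :: "quotient_stack \<Rightarrow> nat \<Rightarrow> nat \<Rightarrow> nat \<Rightarrow> (nat \<Rightarrow> nat) \<Rightarrow> ratfun" where
  "Mst_W W1 p d l dd =
     (LL ^ d - LL ^ l) / (LL - 1) +
     (Mst_X p d l dd - (LL ^ d - LL ^ l)) * ((LL ^ l - 1) / (LL ^ l * (LL - 1)))"
| "Mst_W W2 p d l dd =
     (LL ^ d - LL ^ l) / (LL - 1) +
     (Mst_X p d l dd - (LL ^ d - LL ^ l)) * ((LL ^ l - 1) / (LL ^ l * (LL - 1)))"

end

theory Submission
  imports Defs
begin

text \<open>
  Since \<open>\<lfloor>i s / p\<rfloor> + \<lfloor>i (p - s) / p\<rfloor> = i - 1\<close> for \<open>0 < i, s < p\<close>, the shift function satisfies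
  \<open>sht(s) + sht(p - s) = D - (d - l)\<close>. Hence reversing the order of summation in
  \<open>\<Sum>\<^sub>s L\<^bsup>s - sht(s)\<^esup>\<close> turns the substitution of \<open>1/L\<close> into multiplication by
  \<open>L\<^bsup>D + l - p - d\<^esup>\<close>, so that \<open>T = M\<^sub>s\<^sub>t(X) - L\<^sup>d\<close> satisfies \<open>T(1/L) = L\<^bsup>-d-l\<^esup> T(L)\<close>. The invariant
  equals \<open>(L\<^sup>d - 1)/(L - 1) + T (1 - L\<^bsup>-l\<^esup>)/(L - 1)\<close>, and both summands have the required symmetry.
\<close>

section \<open>Dimension of a direct sum\<close>

text \<open>The definition of \<open>internal_direct_sum\<close> gives uniqueness only among
  extensional families; restricting to \<open>I\<close> carries it over to arbitrary
  families.\<close>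

lemma (in vector_space) internal_direct_sum_unique:
  assumes "internal_direct_sum I U"
    and "\<And>i. i \<in> I \<Longrightarrow> u i \<in> U i" and "\<And>i. i \<in> I \<Longrightarrow> w i \<in> U i"
    and "(\<Sum>i\<in>I. u i) = (\<Sum>i\<in>I. w i)" and "i \<in> I"
  shows "u i = w i"
proof -
  have "\<exists>!x. x \<in> (\<Pi>\<^sub>E i\<in>I. U i) \<and> (\<Sum>i\<in>I. u i) = (\<Sum>i\<in>I. x i)"
    using assms(1) unfolding internal_direct_sum_def by blast
  moreover have "restrict u I \<in> (\<Pi>\<^sub>E i\<in>I. U i)" "restrict w I \<in> (\<Pi>\<^sub>E i\<in>I. U i)"
    using assms(2,3) by auto
  moreover have "(\<Sum>i\<in>I. u i) = (\<Sum>i\<in>I. restrict u I i)" "(\<Sum>i\<in>I. u i) = (\<Sum>i\<in>I. restrict w I i)"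
    using assms(4) by auto
  ultimately have "restrict u I = restrict w I"
    by blast
  then show ?thesis
    using \<open>i \<in> I\<close> by (metis restrict_apply')
qed

text \<open>The union of bases of the summands is a basis of the whole space. Positive dimensions
  guarantee that the chosen bases are finite, since \<open>card\<close> is 0 on infinite
  sets.\<close>

lemma (in vector_space) dim_internal_direct_sum:
  assumes "finite I" and ds: "internal_direct_sum I U"
    and sub: "\<And>i. i \<in> I \<Longrightarrow> subspace (U i)"
    and dim_pos: "\<And>i. i \<in> I \<Longrightarrow> dim (U i) > 0"
  shows "dim UNIV = (\<Sum>i\<in>I. dim (U i))"
proof -
  have "\<exists>B. B \<subseteq> U i \<and> independent B \<and> U i \<subseteq> span B \<and> card B = dim (U i)" for i
    using basis_exists[of "U i"] by metis
  then obtain B where B: "B i \<subseteq> U i" "independent (B i)" "U i \<subseteq> span (B i)"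
    "card (B i) = dim (U i)" for i
    by metis
  have fin: "finite (B i)" if "i \<in> I" for i
    using dim_pos[OF that] B(4)[of i] card_ge_0_finite by metis
  have disj: "B i \<inter> B j = {}" if "i \<in> I" "j \<in> I" "i \<noteq> j" for i j
  proof (rule ccontr)
    assume "B i \<inter> B j \<noteq> {}"
    then obtain v where v: "v \<in> B i" "v \<in> B j"
      by blast
    have *: "(\<Sum>m\<in>I. if m = n then v else 0) = v" if "n \<in> I" for n
      using that \<open>finite I\<close> by simp
    \<comment> \<open>A common basis vector \<open>v\<close> decomposes both as \<open>v\<close> in
      slot \<open>i\<close> and as \<open>v\<close> in slot \<open>j\<close>; uniqueness, compared
      at slot \<open>i\<close>, forces \<open>v = 0\<close>.\<close>
    have "(if i = i then v else 0) = (if i = j then v else 0)"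
      by (rule internal_direct_sum_unique[OF ds, where
            u = "\<lambda>m. if m = i then v else 0" and w = "\<lambda>m. if m = j then v else 0"])
        (use that v B(1) sub * subspace_0 in \<open>auto split: if_splits\<close>)
    then have "v = 0"
      using that by simp
    then show False
      using B(2)[of i] v(1) dependent_zero by blast
  qed
  have sum_Union: "sum f (\<Union>i\<in>I. B i) = (\<Sum>i\<in>I. sum f (B i))" for f :: "'b \<Rightarrow> 'b"
    using \<open>finite I\<close> fin disj by (intro sum.UNION_disjoint) auto
  have finU: "finite (\<Union>i\<in>I. B i)"
    using \<open>finite I\<close> fin by auto
  have indep: "independent (\<Union>i\<in>I. B i)"
  proof
    assume "dependent (\<Union>i\<in>I. B i)"
    then obtain c i v where c: "i \<in> I" "v \<in> B i" "c v \<noteq> 0" "(\<Sum>v\<in>(\<Union>i\<in>I. B i). c v *s v) = 0"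
      unfolding dependent_finite[OF finU] by auto
    \<comment> \<open>Grouping the vanishing combination by summands decomposes 0, so each group
      vanishes by uniqueness.\<close>
    have "(\<Sum>v\<in>B i. c v *s v) = 0"
    proof (rule internal_direct_sum_unique[OF ds, where
          u = "\<lambda>i. \<Sum>v\<in>B i. c v *s v" and w = "\<lambda>_. 0"])
      show "(\<Sum>v\<in>B j. c v *s v) \<in> U j" if "j \<in> I" for j
        using B(1)[of j] sub[OF that] by (intro subspace_sum) (auto intro: subspace_scale)
    qed (use c sub subspace_0 sum_Union in auto)
    then have "dependent (B i)"
      using c dependent_finite[OF fin[OF c(1)]] by blast
    then show False
      using B(2) by blast
  qed
  have "v \<in> span (\<Union>i\<in>I. B i)" for v
  proof -
    obtain u where u: "u \<in> (\<Pi>\<^sub>E i\<in>I. U i)" "v = (\<Sum>i\<in>I. u i)"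
      using ds unfolding internal_direct_sum_def by blast
    have "u i \<in> span (\<Union>i\<in>I. B i)" if "i \<in> I" for i
      using u(1) that B(3)[of i] span_mono[of "B i" "\<Union>i\<in>I. B i"] by (auto simp: PiE_iff)
    then show ?thesis
      unfolding u(2) by (rule span_sum)
  qed
  then have "span (\<Union>i\<in>I. B i) = span UNIV"
    by auto
  then have "dim UNIV = card (\<Union>i\<in>I. B i)"
    using indep by (rule dim_eq_card)
  also have "\<dots> = (\<Sum>i\<in>I. card (B i))"
    using \<open>finite I\<close> fin disj by (intro card_UN_disjoint) auto
  finally show ?thesis
    using B(4) by simp
qed


section \<open>Symmetry of the shift function\<close>

text \<open>The numbers \<open>i * s\<close> and \<open>i * (p - s)\<close> add up to
  \<open>i * p\<close> and neither is divisible by \<open>p\<close>. Their remainders therefore add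
  up to exactly \<open>p\<close>, which costs the quotients one unit.\<close>

lemma div_add_div_complement:
  fixes p i s :: nat
  assumes "\<not> p dvd i * s" and "s \<le> p"
  shows "i * s div p + i * (p - s) div p = i - 1"
proof -
  have "p > 0" "i > 0"
    using assms by (auto intro: Nat.gr0I)
  define q r where "q = i * s div p" and "r = i * s mod p"
  have qr: "i * s = q * p + r" and r: "0 < r" "r < p"
    using assms \<open>p > 0\<close> by (auto simp: q_def r_def mod_greater_zero_iff_not_dvd)
  have "q < i"
  proof (rule ccontr)
    assume "\<not> q < i"
    then have "i * s \<le> q * p"
      using assms(2) by (intro mult_le_mono) auto
    then show False
      using qr r by simp
  qed
  then obtain t where t: "i = q + t + 1"
    using less_imp_Suc_add by (metis Suc_eq_plus1)
  have "i * (p - s) + i * s = i * p"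
    using assms(2) by (simp flip: add_mult_distrib2)
  then have "i * (p - s) = (p - r) + t * p"
    using qr r t by (simp add: algebra_simps)
  moreover have "(p - r) div p = 0"
    using r by (intro div_less) linarith
  ultimately have "i * (p - s) div p = t"
    using \<open>p > 0\<close> by simp
  then show ?thesis
    using t unfolding q_def[symmetric] by linarith
qed

text \<open>Pairing the floors leaves the sum of \<open>i - 1\<close> over \<open>i < n\<close> for
  a block of size \<open>n\<close>, which is \<open>n (n - 1) / 2 - (n - 1)\<close>. Moving the
  subtracted terms to the left leaves \<open>+ 1\<close> per block, hence \<open>l\<close>.\<close>

lemma sht_complement:
  assumes "prime p" and "1 \<le> s" "s < p" and dd: "\<And>j. j \<in> {1..l} \<Longrightarrow> 1 \<le> dd j \<and> dd j \<le> p"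
  shows "sht p l dd s + sht p l dd (p - s) + (\<Sum>j=1..l. dd j) = D_inv l dd + l"
proof -
  have summand: "(\<Sum>i=1..n - 1. i * s div p) + (\<Sum>i=1..n - 1. i * (p - s) div p) + n
      = (n - 1) * n div 2 + 1" if "1 \<le> n" "n \<le> p" for n
  proof -
    have "(\<Sum>i=1..n - 1. i * s div p) + (\<Sum>i=1..n - 1. i * (p - s) div p) = (\<Sum>i=1..n - 1. i - 1)"
      unfolding sum.distrib[symmetric]
    proof (rule sum.cong[OF refl])
      fix i assume "i \<in> {1..n - 1}"
      \<comment> \<open>Both \<open>i\<close> and \<open>s\<close> lie strictly between 0 and
        \<open>p\<close>; primality then excludes that \<open>p\<close> divides the product.\<close>
      then have "\<not> p dvd i" "\<not> p dvd s"
        using that assms(2,3) by (auto dest!: dvd_imp_le)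
      then show "i * s div p + i * (p - s) div p = i - 1"
        using assms(1,3) by (intro div_add_div_complement) (auto simp: prime_dvd_mult_iff)
    qed
    moreover have "(\<Sum>i=1..n - 1. i - 1) + n = (n - 1) * n div 2 + 1"
    proof -
      have "(\<Sum>i=1..n - 1. i - 1) + (n - 1) = (\<Sum>i=1..n - 1. (i - 1) + 1)"
        unfolding sum.distrib by simp
      also have "\<dots> = \<Sum>{1..n - 1}"
        by (rule sum.cong) auto
      also have "\<dots> = (n - 1) * n div 2"
        using gauss_sum_from_Suc_0[of "n - 1", where ?'a = nat] that(1) by simp
      finally show ?thesis
        using that(1) by simp
    qed
    ultimately show ?thesis
      by simp
  qed
  have "sht p l dd s + sht p l dd (p - s) + (\<Sum>j=1..l. dd j) =
      (\<Sum>j=1..l. (\<Sum>i=1..dd j - 1. i * s div p) + (\<Sum>i=1..dd j - 1. i * (p - s) div p) + dd j)"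
    by (simp only: sht_def sum.distrib)
  also have "\<dots> = (\<Sum>j=1..l. (dd j - 1) * dd j div 2 + 1)"
    by (intro sum.cong refl summand) (use dd in auto)
  finally show ?thesis
    unfolding D_inv_def sum.distrib by simp
qed


section \<open>Substitution into rational functions\<close>

lemma ratfun_const_0 [simp]: "ratfun_const 0 = 0"
  and ratfun_const_1 [simp]: "ratfun_const 1 = 1"
  and ratfun_const_add: "ratfun_const (a + b) = ratfun_const a + ratfun_const b"
  and ratfun_const_mult: "ratfun_const (a * b) = ratfun_const a * ratfun_const b"
  by (simp_all add: ratfun_const_def pCons_one flip: to_fract_add to_fract_mult)

text \<open>The ring homomorphism from integer polynomials that sends the indeterminate to
  \<open>g\<close>; \<open>ratfun_subst\<close> applies it to numerator and denominator.\<close>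

definition poly_subst :: "ratfun \<Rightarrow> int poly \<Rightarrow> ratfun" where
  "poly_subst g a = poly (map_poly ratfun_const a) g"

lemma poly_subst_0 [simp]: "poly_subst g 0 = 0"
  and poly_subst_pCons: "poly_subst g (pCons c a) = ratfun_const c + g * poly_subst g a"
  by (simp_all add: poly_subst_def map_poly_pCons)

lemma poly_subst_1 [simp]: "poly_subst g 1 = 1"
  by (simp add: poly_subst_pCons flip: pCons_one)

lemma poly_subst_add: "poly_subst g (a + b) = poly_subst g a + poly_subst g b"
  by (induction a b rule: poly_induct2) (simp_all add: poly_subst_pCons ratfun_const_add algebra_simps)

lemma poly_subst_smult: "poly_subst g (smult c a) = ratfun_const c * poly_subst g a"
  by (induction a) (simp_all add: poly_subst_pCons ratfun_const_mult algebra_simps)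

lemma poly_subst_mult: "poly_subst g (a * b) = poly_subst g a * poly_subst g b"
  by (induction a) (simp_all add: poly_subst_pCons poly_subst_add poly_subst_smult algebra_simps)

lemma poly_subst_LL: "poly_subst LL a = to_fract a"
proof (induction a)
  case (pCons c a)
  have "pCons c a = [:c:] + [:0, 1:] * a"
    by simp
  then have "to_fract (pCons c a) = ratfun_const c + LL * to_fract a"
    by (metis LL_def ratfun_const_def to_fract_add to_fract_mult)
  then show ?case
    by (simp add: poly_subst_pCons pCons.IH)
qed simp

lemma LL_nonzero [simp]: "LL \<noteq> 0"
  by (simp add: LL_def)

text \<open>Multiplying the value at \<open>inverse LL\<close> by \<open>LL ^ degree a\<close> gives
  the polynomial with reversed coefficients, which is nonzero.\<close>

lemma poly_subst_inverse_LL_nonzero: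
  assumes "a \<noteq> 0"
  shows "poly_subst (inverse LL) a \<noteq> 0"
proof
  assume "poly_subst (inverse LL) a = 0"
  have inj: "ratfun_const c = 0 \<longleftrightarrow> c = 0" for c
    by (simp add: ratfun_const_def)
  have deg: "degree (map_poly ratfun_const a) = degree a"
    by (rule map_poly_degree_eq) (use assms inj in auto)
  have "reflect_poly (map_poly ratfun_const a) = map_poly ratfun_const (reflect_poly a)"
    by (rule poly_eqI) (simp add: coeff_reflect_poly coeff_map_poly deg)
  then have "to_fract (reflect_poly a) = LL ^ degree a * poly_subst (inverse LL) a"
    using poly_reflect_poly_nz[OF LL_nonzero, of "map_poly ratfun_const a"]
    by (simp add: poly_subst_def deg flip: poly_subst_LL)
  then show False
    using assms \<open>poly_subst (inverse LL) a = 0\<close> by simp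
qed

text \<open>The assumption says that \<open>g\<close> is transcendental over the rationals. No
  denominator can then vanish, so substitution is a field homomorphism.\<close>

locale ratfun_substitution =
  fixes g :: ratfun
  assumes poly_subst_nonzero: "a \<noteq> 0 \<Longrightarrow> poly_subst g a \<noteq> 0"
begin

text \<open>Independence of the chosen fraction: cross-multiplying with the reduced fraction gives a
  polynomial identity, which survives substitution.\<close>

lemma subst_divide_to_fract:
  assumes "b \<noteq> 0"
  shows "ratfun_subst (to_fract a / to_fract b) g = poly_subst g a / poly_subst g b"
proof -
  define R where "R = to_fract a / to_fract b"
  define u v where "u = fst (quot_of_fract R)" and "v = snd (quot_of_fract R)"
  have v: "v \<noteq> 0"
    by (simp add: v_def)
  have "to_fract u / to_fract v = to_fract a / to_fract b"
    by (metis R_def u_def v_def Fract_conv_to_fract Fract_quot_of_fract)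
  then have "to_fract (u * b) = to_fract (a * v)"
    using assms v by (simp add: field_simps)
  then have "u * b = a * v"
    by (simp only: to_fract_eq_iff)
  then have "poly_subst g u * poly_subst g b = poly_subst g a * poly_subst g v"
    by (metis poly_subst_mult)
  moreover have "ratfun_subst R g = poly_subst g u / poly_subst g v"
    by (simp add: ratfun_subst_def poly_subst_def u_def v_def)
  ultimately show ?thesis
    unfolding R_def[symmetric] using assms v by (metis frac_eq_eq poly_subst_nonzero)
qed

lemma ratfun_cases:
  fixes R :: ratfun
  obtains a b where "b \<noteq> 0" "R = to_fract a / to_fract b"
  by (metis Fract_conv_to_fract Fract_quot_of_fract snd_quot_of_fract_nonzero)

lemma subst_to_fract: "ratfun_subst (to_fract a) g = poly_subst g a"
  using subst_divide_to_fract[of 1 a] by simp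

lemma subst_0: "ratfun_subst 0 g = 0" and subst_1: "ratfun_subst 1 g = 1"
  using subst_to_fract[of 0] subst_to_fract[of 1] by simp_all

lemma subst_LL: "ratfun_subst LL g = g"
  by (simp add: LL_def subst_to_fract poly_subst_pCons)

lemma subst_add: "ratfun_subst (R + S) g = ratfun_subst R g + ratfun_subst S g"
proof -
  obtain a b where R: "b \<noteq> 0" "R = to_fract a / to_fract b"
    by (rule ratfun_cases)
  obtain c e where S: "e \<noteq> 0" "S = to_fract c / to_fract e"
    by (rule ratfun_cases)
  have "R + S = to_fract (a * e + c * b) / to_fract (b * e)"
    using R S by (simp add: field_simps)
  then show ?thesis
    using R S poly_subst_nonzero
    by (simp add: subst_divide_to_fract poly_subst_add poly_subst_mult add_frac_eq
        del: to_fract_add to_fract_mult)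
qed

lemma subst_mult: "ratfun_subst (R * S) g = ratfun_subst R g * ratfun_subst S g"
proof -
  obtain a b where R: "b \<noteq> 0" "R = to_fract a / to_fract b"
    by (rule ratfun_cases)
  obtain c e where S: "e \<noteq> 0" "S = to_fract c / to_fract e"
    by (rule ratfun_cases)
  have "R * S = to_fract (a * c) / to_fract (b * e)"
    using R S by simp
  then show ?thesis
    using R S by (simp add: subst_divide_to_fract poly_subst_mult del: to_fract_mult)
qed

lemma subst_diff: "ratfun_subst (R - S) g = ratfun_subst R g - ratfun_subst S g"
  using subst_add[of "R - S" S] by simp

lemma subst_inverse: "ratfun_subst (inverse R) g = inverse (ratfun_subst R g)"
proof (cases "R = 0")
  case False
  then have "ratfun_subst (inverse R) g * ratfun_subst R g = 1"
    by (simp add: subst_1 flip: subst_mult)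
  then show ?thesis
    by (metis inverse_unique mult.commute)
\<comment> \<open>For \<open>R = 0\<close> both sides are 0 because
  \<open>inverse 0 = 0\<close>.\<close>
qed (simp add: subst_0)

lemma subst_divide: "ratfun_subst (R / S) g = ratfun_subst R g / ratfun_subst S g"
  by (simp add: divide_inverse subst_mult subst_inverse)

lemma subst_power: "ratfun_subst (R ^ n) g = ratfun_subst R g ^ n"
  by (induction n) (simp_all add: subst_1 subst_mult)

lemma subst_powi: "ratfun_subst (R powi n) g = ratfun_subst R g powi n"
  by (simp add: power_int_def subst_power subst_inverse)

lemma subst_sum: "ratfun_subst (\<Sum>i\<in>I. f i) g = (\<Sum>i\<in>I. ratfun_subst (f i) g)"
  by (induction I rule: infinite_finite_induct) (simp_all add: subst_0 subst_add)

lemmas subst_simps = subst_0 subst_1 subst_LL subst_add subst_diff subst_mult subst_divide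
  subst_power subst_powi subst_sum

end

interpretation inverse_LL: ratfun_substitution "inverse LL"
  by standard (rule poly_subst_inverse_LL_nonzero)

text \<open>A degree comparison among polynomials; it keeps the denominators of the invariants
  nonzero.\<close>

lemma LL_power_neq_1: "n > 0 \<Longrightarrow> LL ^ n \<noteq> 1"
proof
  assume "n > 0" "LL ^ n = 1"
  have "to_fract ([:0, 1:] ^ n) = LL ^ n" for n
    by (induction n) (simp_all only: LL_def power_0 power_Suc to_fract_1 to_fract_mult)
  then have "([:0, 1:] :: int poly) ^ n = 1"
    using \<open>LL ^ n = 1\<close> by (metis to_fract_1 to_fract_eq_iff)
  then have "degree (([:0, 1:] :: int poly) ^ n) = 0"
    by simp
  then show False
    using \<open>n > 0\<close> by (simp add: degree_power_eq)
qed


section \<open>The duality\<close>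

definition sht_sum :: "nat \<Rightarrow> nat \<Rightarrow> (nat \<Rightarrow> nat) \<Rightarrow> ratfun" where
  "sht_sum p l dd = (\<Sum>s=1..p - 1. LL powi (int s - int (sht p l dd s)))"

text \<open>This is the \<open>T\<close> of the overview, the difference of \<open>Mst_X\<close> and
  \<open>LL ^ d\<close>.\<close>

definition Mst_sing :: "nat \<Rightarrow> nat \<Rightarrow> (nat \<Rightarrow> nat) \<Rightarrow> ratfun" where
  "Mst_sing p l dd =
     LL powi (int l - 1) * (LL - 1) * sht_sum p l dd / (1 - LL powi (int p - 1 - int (D_inv l dd)))"

text \<open>The bracket in \<open>Mst_W\<close> is \<open>Mst_sing + LL ^ l\<close>. Its part
  \<open>LL ^ l\<close> contributes \<open>(LL ^ l - 1) / (LL - 1)\<close>, which telescopes with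
  the leading term.\<close>

lemma Mst_W_eq:
  "Mst_W W p d l dd = (LL ^ d - 1) / (LL - 1) + Mst_sing p l dd * (1 - LL powi - int l) / (LL - 1)"
proof -
  have "LL - 1 \<noteq> 0"
    using LL_power_neq_1[of 1] by simp
  have "Mst_W W p d l dd = (LL ^ d - LL ^ l) / (LL - 1) +
     (Mst_sing p l dd + LL ^ l) * ((LL ^ l - 1) / (LL ^ l * (LL - 1)))"
    by (cases W) (simp_all add: Mst_X_def Mst_sing_def sht_sum_def)
  also have "\<dots> = (LL ^ d - 1) / (LL - 1) + Mst_sing p l dd * (1 - inverse (LL ^ l)) / (LL - 1)"
    using \<open>LL - 1 \<noteq> 0\<close> by (simp add: divide_simps) (simp add: algebra_simps)
  finally show ?thesis
    by (simp add: power_int_minus)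
qed

lemma sht_sum_subst:
  assumes "prime p" and "\<And>j. j \<in> {1..l} \<Longrightarrow> 1 \<le> dd j \<and> dd j \<le> p" and d: "d = (\<Sum>j=1..l. dd j)"
  shows "ratfun_subst (sht_sum p l dd) (inverse LL) =
    LL powi (int (D_inv l dd) + int l - int p - int d) * sht_sum p l dd"
proof -
  have "ratfun_subst (sht_sum p l dd) (inverse LL) =
      (\<Sum>s=1..p - 1. LL powi (int (sht p l dd s) - int s))"
    by (simp add: sht_sum_def inverse_LL.subst_simps power_int_inverse flip: power_int_minus)
  also have "\<dots> = (\<Sum>s=1..p - 1. LL powi (int (D_inv l dd) + int l - int p - int d) *
      LL powi (int s - int (sht p l dd s)))"
  proof (rule sum.reindex_bij_witness[of _ "\<lambda>s. p - s" "\<lambda>s. p - s"])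
    fix s assume s: "s \<in> {1..p - 1}"
    then have "sht p l dd s + sht p l dd (p - s) + d = D_inv l dd + l"
      unfolding d using assms(1,2) by (intro sht_complement) auto
    \<comment> \<open>The \<open>- int p\<close> in the constant comes from writing
      \<open>- s\<close> as \<open>(p - s) - p\<close>.\<close>
    then have "int (sht p l dd s) - int s = (int (D_inv l dd) + int l - int p - int d) +
        (int (p - s) - int (sht p l dd (p - s)))"
      using s by auto
    then show "LL powi (int (D_inv l dd) + int l - int p - int d) *
        LL powi (int (p - s) - int (sht p l dd (p - s))) = LL powi (int (sht p l dd s) - int s)"
      by (simp only: power_int_add[of LL, OF disjI1, OF LL_nonzero])
  qed auto
  finally show ?thesis
    by (simp add: sht_sum_def sum_distrib_left)
qed

lemma Mst_sing_subst:
  assumes "prime p" and "\<And>j. j \<in> {1..l} \<Longrightarrow> 1 \<le> dd j \<and> dd j \<le> p" and d: "d = (\<Sum>j=1..l. dd j)"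
    and D: "D_inv l dd \<ge> p"
  shows "ratfun_subst (Mst_sing p l dd) (inverse LL) = LL powi (- int d - int l) * Mst_sing p l dd"
proof -
  define S where "S = sht_sum p l dd"
  \<comment> \<open>With \<open>m = D - p\<close> the exponent in the denominator is
    \<open>- (m + 1)\<close>, so it is strictly negative and the denominator is nonzero.\<close>
  obtain m where m: "D_inv l dd = p + m"
    using D le_Suc_ex by blast
  have S: "ratfun_subst S (inverse LL) = LL powi (int m + int l - int d) * S"
    unfolding S_def using sht_sum_subst[OF assms(1-3)] by (simp add: m)
  have ne: "LL ^ Suc m \<noteq> 1"
    by (rule LL_power_neq_1) simp
  have e: "int p - 1 - int (D_inv l dd) = - int (Suc m)"
    using m by simp
  have "ratfun_subst (Mst_sing p l dd) (inverse LL) =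
      LL powi (1 - int l) * (inverse LL - 1) * (LL powi (int m + int l - int d) * S) / (1 - LL ^ Suc m)"
    unfolding Mst_sing_def e S_def[symmetric] inverse_LL.subst_simps S power_int_inverse
    by (simp add: power_int_minus[symmetric] power_int_of_nat del: power_Suc of_nat_Suc)
  \<comment> \<open>Factor \<open>- 1 / LL\<close> out of \<open>inverse LL - 1\<close> and
    \<open>- LL ^ (m + 1)\<close> out of the denominator: the signs cancel, and the powers of
    \<open>LL\<close> total \<open>- d - 1\<close> on both sides.\<close>
  also have "\<dots> = LL powi (- int d - int l) *
      (LL powi (int l - 1) * (LL - 1) * S / (1 - inverse (LL ^ Suc m)))"
    using ne
    by (simp add: divide_simps power_int_add power_int_diff power_int_minus)
      (simp add: algebra_simps)
  finally show ?thesis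
    by (simp add: Mst_sing_def e S_def power_int_minus del: power_Suc of_nat_Suc)
qed

theorem proposition6p35:
  fixes scale :: "'k :: field \<Rightarrow> 'v :: ab_group_add \<Rightarrow> 'v"
    and \<rho> :: "int \<Rightarrow> 'v \<Rightarrow> 'v"
    and p d l :: nat and dd :: "nat \<Rightarrow> nat"
    and W :: quotient_stack
  assumes "perfect_field_of_char p TYPE('k)"
    and "group_representation (integer_mod_group p) scale \<rho>"
    and "vector_space.dim scale (UNIV :: 'v set) = d"
    and "decomposes_as p scale \<rho> l dd"
    and "D_inv l dd \<ge> p"
  shows "ratfun_subst (Mst_W W p d l dd) (inverse LL) * LL powi (int d - 1) = Mst_W W p d l dd"
proof -
  interpret vector_space scale
    using assms(2) by (simp add: group_representation_def)
  \<comment> \<open>The characteristic of a field is 0 or prime, and \<open>p > 0\<close>.\<close>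
  have p: "prime p"
    using assms(1) prime_CHAR_semidom[where ?'a = 'k] by (auto simp: perfect_field_of_char_def)
  obtain U where U: "internal_direct_sum {1..l} U"
    "\<forall>j\<in>{1..l}. indecomposable_subrepresentation (integer_mod_group p) scale \<rho> (U j) \<and>
       1 \<le> dd j \<and> dd j \<le> p \<and> dim (U j) = dd j"
    using assms(4) unfolding decomposes_as_def by (elim exE conjE)
  then have sub: "subspace (U j)" and dd: "1 \<le> dd j \<and> dd j \<le> p" and dim: "dim (U j) = dd j"
    if "j \<in> {1..l}" for j
    using that by (auto simp: indecomposable_subrepresentation_def subrepresentation_def)
  \<comment> \<open>The symmetry lemmas need the dimension as the sum of block sizes;
    \<open>1 \<le> dd j\<close> supplies the required positivity.\<close>
  have d: "d = (\<Sum>j=1..l. dd j)"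
  proof -
    have "dim (UNIV :: 'v set) = (\<Sum>j=1..l. dim (U j))"
      by (rule dim_internal_direct_sum) (use U(1) sub dim dd in force)+
    then show ?thesis
      using dim assms(3) by simp
  qed
  define T where "T = Mst_sing p l dd"
  have T: "ratfun_subst T (inverse LL) = LL powi (- int d - int l) * T"
    unfolding T_def by (rule Mst_sing_subst[OF p dd d assms(5)])
  have "LL \<noteq> 1"
    using LL_power_neq_1[of 1] by simp
  have "ratfun_subst (Mst_W W p d l dd) (inverse LL) =
      (inverse (LL ^ d) - 1) / (inverse LL - 1) +
      LL powi (- int d - int l) * T * (1 - LL ^ l) / (inverse LL - 1)"
    unfolding Mst_W_eq T_def[symmetric] inverse_LL.subst_simps T
    by (simp add: power_int_inverse power_int_minus power_inverse)
  \<comment> \<open>The factor \<open>LL powi (d - 1)\<close> supplies \<open>LL ^ d\<close> to the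
    numerators and \<open>LL\<close> to the denominator \<open>inverse LL - 1\<close>; numerator and
    denominator both change sign.\<close>
  also have "\<dots> * LL powi (int d - 1) =
      (LL ^ d - 1) / (LL - 1) + T * (1 - inverse (LL ^ l)) / (LL - 1)"
    using \<open>LL \<noteq> 1\<close>
    by (simp add: divide_simps power_int_diff power_int_minus) (simp add: algebra_simps)
  finally show ?thesis
    by (simp add: Mst_W_eq T_def power_int_minus)
qed

end
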